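(* Let $\Omega$ be a nonempty set and $k:\Omega\times\Omega\to\mathbb{R}$ a positive definite kernel with reproducing kernel Hilbert space $\mathcal{H}_k(\Omega)$. Let $m_p,m_q,n_p,n_q\in\mathbb{N}_0$ with $m_p\ge n_p$ and $m_q\ge n_q$, let $p:\mathbb{R}^{m_p}\to\mathbb{R}^{n_p}$ and $q:\mathbb{R}^{m_q}\to\mathbb{R}^{n_q}$ be continuous, let $\lambda_p\in(\mathcal{H}_k(\Omega)')^{m_p}$ and $\lambda_q\in(\mathcal{H}_k(\Omega)')^{m_q}$ be vectors of continuous linear functionals, and let $r_p\in\mathbb{R}^{n_p}$, $r_q\in\mathbb{R}^{n_q}$. Let $\Lambda:=[\lambda_p^\top\ \lambda_q^\top]^\top\in(\mathcal{H}_k(\Omega)')^{m_p+m_q}$ and assume that the components of $\Lambda$ are linearly independent. Assume further that there exists $\bar s\in\mathcal{H}_k(\Omega)$ with $p(\lambda_p(\bar s))=r_p$ and $q(\lambda_q(\bar s))\ge r_q$. Then the problem $$\text{(P)}\qquad \min_{s\in\mathcal{H}_k(\Omega)}\|s\|_{\mathcal{H}_k(\Omega)}\quad\text{s.t.}\quad p(\lambda_p(s))=r_p,\quad q(\lambda_q(s))\ge r_q$$ admits a minimizer, and (P) is equivalent to the finite-dimensional problem $$\text{(F)}\qquad \min_{z_p\in\mathbb{R}^{m_p},\,z_q\in\mathbb{R}^{m_q}}\left\langle\begin{bmatrix} z_p \\ z_q \end{bmatrix},\mathcal{K}_\Lambda^{-1}\begin{bmatrix} z_p \\ z_q \end{bmatrix}\right\rangle\quad\text{s.t.}\quad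 p(z_p)=r_p,\quad q(z_q)\ge r_q$$ in the following sense: (a) If $(z_p^*,z_q^* )$ solves (F), then the (unique) minimal-norm interpolant $$s^*=\operatorname*{arg\,min}_{s\in\mathcal{H}_k(\Omega)}\bigl\{\|s\|_{\mathcal{H}_k(\Omega)}\ \big|\ \lambda_p(s)=z_p^*,\ \lambda_q(s)=z_q^*\bigr\}$$ is a minimizer of (P). (b) Conversely, if $s^*$ minimizes (P), then $z_p^*=\lambda_p(s^* )$ and $z_q^*=\lambda_q(s^* )$ solve (F).
   Context: A kernel is a symmetric function $k:\Omega\times\Omega\to\mathbb{R}$; it is positive definite if for every finite set of pairwise distinct points $x_1,\dots,x_n\in\Omega$ the matrix $(k(x_i,x_j))_{i,j}$ is positive semidefinite. $\mathcal{H}_k(\Omega)$ is the unique Hilbert space of real-valued functions on $\Omega$ with reproducing kernel $k$, and $\mathcal{H}_k(\Omega)'$ is its dual. For a vector of functionals $\lambda=[\lambda_1\ \dots\ \lambda_m]$ one writes $\lambda(s)=[\lambda_1(s)\ \dots\ \lambda_m(s)]^\top\in\mathbb{R}^m$. Inequalities between vectors are componentwise. For $\Lambda$ with components $\Lambda_1,\dots,\Lambda_{m}$ ($m=m_p+m_q$) and Riesz representers $w_1,\dots,w_m\in\mathcal{H}_k(\Omega)$, the generalized Gramian is $\mathcal{K}_\Lambda:=(\langle w_i,w_j\rangle_{\mathcal{H}_k(\Omega)})_{i,j=1}^{m}$, which is symmetric positive definite when the components of $\Lambda$ are linearly independent. *)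

theory Defs
  imports
    "HOL-Analysis.Analysis"
    "Jordan_Normal_Form.Gauss_Jordan_Elimination"
begin

definition positive_definite_kernel :: "'a set \<Rightarrow> ('a \<Rightarrow> 'a \<Rightarrow> real) \<Rightarrow> bool" where
  "positive_definite_kernel \<Omega> k \<longleftrightarrow>
     (\<forall>x\<in>\<Omega>. \<forall>y\<in>\<Omega>. k x y = k y x) \<and>
     (\<forall>X c. finite X \<and> X \<subseteq> \<Omega> \<longrightarrow> 0 \<le> (\<Sum>x\<in>X. \<Sum>y\<in>X. c x * k x y * c y))"

text \<open>
  A Hilbert space of functions on \<open>\<Omega>\<close> is presented by a Hilbert space type \<open>'h\<close> together
  with the map \<open>ev\<close> sending an element to the function it stands for; \<open>ev s\<close> is only
  looked at on \<open>\<Omega>\<close>. The first two conjuncts say that elements of \<open>'h\<close> are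
  functions on \<open>\<Omega>\<close> with pointwise linear structure (linearity and injectivity of
  \<open>s \<mapsto> ev s\<close> restricted to \<open>\<Omega>\<close>), the last one that \<open>k(_, x)\<close> belongs to the space and
  has the reproducing property.
\<close>

definition is_RKHS ::
  "'a set \<Rightarrow> ('a \<Rightarrow> 'a \<Rightarrow> real) \<Rightarrow> ('h::{real_inner,complete_space} \<Rightarrow> 'a \<Rightarrow> real) \<Rightarrow> bool" where
  "is_RKHS \<Omega> k ev \<longleftrightarrow>
     (\<forall>x\<in>\<Omega>. linear (\<lambda>s. ev s x)) \<and>
     (\<forall>s t. (\<forall>x\<in>\<Omega>. ev s x = ev t x) \<longrightarrow> s = t) \<and>
     (\<forall>x\<in>\<Omega>. \<exists>h. (\<forall>y\<in>\<Omega>. ev h y = k y x) \<and> (\<forall>s. ev s x = inner s h))"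

text \<open>
  The vector space of real \<open>n\<close>-tuples is \<open>Euclidean_space n\<close>: sequences vanishing from index
  \<open>n\<close> on, with the product topology. A vector of \<open>m\<close> functionals is a sequence of elements of
  the dual \<open>'h \<Rightarrow>\<^sub>L real\<close>, of which only the first \<open>m\<close> terms matter.
\<close>

definition apply_functionals ::
  "nat \<Rightarrow> (nat \<Rightarrow> 'h::real_normed_vector \<Rightarrow>\<^sub>L real) \<Rightarrow> 'h \<Rightarrow> nat \<Rightarrow> real" where
  "apply_functionals m \<phi> s = (\<lambda>i. if i < m then blinfun_apply (\<phi> i) s else 0)"

definition vec_ge :: "nat \<Rightarrow> (nat \<Rightarrow> real) \<Rightarrow> (nat \<Rightarrow> real) \<Rightarrow> bool" where
  "vec_ge n u v \<longleftrightarrow> (\<forall>i<n. v i \<le> u i)"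

definition stack :: "nat \<Rightarrow> (nat \<Rightarrow> 'b) \<Rightarrow> (nat \<Rightarrow> 'b) \<Rightarrow> nat \<Rightarrow> 'b" where
  "stack m u v = (\<lambda>i. if i < m then u i else v (i - m))"

definition riesz :: "('h::{real_inner,complete_space} \<Rightarrow>\<^sub>L real) \<Rightarrow> 'h" where
  "riesz \<phi> = (THE w. \<forall>s. blinfun_apply \<phi> s = inner s w)"

definition gramian ::
  "nat \<Rightarrow> (nat \<Rightarrow> 'h::{real_inner,complete_space} \<Rightarrow>\<^sub>L real) \<Rightarrow> real Matrix.mat" where
  "gramian m \<Lambda> = Matrix.mat m m (\<lambda>(i, j). inner (riesz (\<Lambda> i)) (riesz (\<Lambda> j)))"

text \<open>\<open>mat_inverse\<close> returns \<open>None\<close> on singular matrices; the value is then unspecified.\<close>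

definition inverse_form :: "nat \<Rightarrow> real Matrix.mat \<Rightarrow> (nat \<Rightarrow> real) \<Rightarrow> real" where
  "inverse_form m K z =
     scalar_prod (Matrix.vec m z) (mult_mat_vec (the (mat_inverse K)) (Matrix.vec m z))"

definition P_feasible ::
  "nat \<Rightarrow> nat \<Rightarrow> nat \<Rightarrow>
   ((nat \<Rightarrow> real) \<Rightarrow> nat \<Rightarrow> real) \<Rightarrow> ((nat \<Rightarrow> real) \<Rightarrow> nat \<Rightarrow> real) \<Rightarrow>
   (nat \<Rightarrow> 'h::real_normed_vector \<Rightarrow>\<^sub>L real) \<Rightarrow> (nat \<Rightarrow> 'h \<Rightarrow>\<^sub>L real) \<Rightarrow>
   (nat \<Rightarrow> real) \<Rightarrow> (nat \<Rightarrow> real) \<Rightarrow> 'h \<Rightarrow> bool" where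
  "P_feasible m\<^sub>p m\<^sub>q n\<^sub>q p q \<phi>\<^sub>p \<phi>\<^sub>q r\<^sub>p r\<^sub>q s \<longleftrightarrow>
     p (apply_functionals m\<^sub>p \<phi>\<^sub>p s) = r\<^sub>p \<and>
     vec_ge n\<^sub>q (q (apply_functionals m\<^sub>q \<phi>\<^sub>q s)) r\<^sub>q"

definition F_feasible ::
  "nat \<Rightarrow> nat \<Rightarrow> nat \<Rightarrow>
   ((nat \<Rightarrow> real) \<Rightarrow> nat \<Rightarrow> real) \<Rightarrow> ((nat \<Rightarrow> real) \<Rightarrow> nat \<Rightarrow> real) \<Rightarrow>
   (nat \<Rightarrow> real) \<Rightarrow> (nat \<Rightarrow> real) \<Rightarrow> (nat \<Rightarrow> real) \<times> (nat \<Rightarrow> real) \<Rightarrow> bool" where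
  "F_feasible m\<^sub>p m\<^sub>q n\<^sub>q p q r\<^sub>p r\<^sub>q = (\<lambda>(z\<^sub>p, z\<^sub>q).
     z\<^sub>p \<in> topspace (Euclidean_space m\<^sub>p) \<and> z\<^sub>q \<in> topspace (Euclidean_space m\<^sub>q) \<and>
     p z\<^sub>p = r\<^sub>p \<and> vec_ge n\<^sub>q (q z\<^sub>q) r\<^sub>q)"

definition F_objective ::
  "nat \<Rightarrow> nat \<Rightarrow> (nat \<Rightarrow> 'h::{real_inner,complete_space} \<Rightarrow>\<^sub>L real) \<Rightarrow>
   (nat \<Rightarrow> real) \<times> (nat \<Rightarrow> real) \<Rightarrow> real" where
  "F_objective m\<^sub>p m\<^sub>q \<Lambda> = (\<lambda>(z\<^sub>p, z\<^sub>q).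
     inverse_form (m\<^sub>p + m\<^sub>q) (gramian (m\<^sub>p + m\<^sub>q) \<Lambda>) (stack m\<^sub>p z\<^sub>p z\<^sub>q))"

definition interpolates ::
  "nat \<Rightarrow> nat \<Rightarrow>
   (nat \<Rightarrow> 'h::real_normed_vector \<Rightarrow>\<^sub>L real) \<Rightarrow> (nat \<Rightarrow> 'h \<Rightarrow>\<^sub>L real) \<Rightarrow>
   (nat \<Rightarrow> real) \<Rightarrow> (nat \<Rightarrow> real) \<Rightarrow> 'h \<Rightarrow> bool" where
  "interpolates m\<^sub>p m\<^sub>q \<phi>\<^sub>p \<phi>\<^sub>q z\<^sub>p z\<^sub>q s \<longleftrightarrow>
     apply_functionals m\<^sub>p \<phi>\<^sub>p s = z\<^sub>p \<and> apply_functionals m\<^sub>q \<phi>\<^sub>q s = z\<^sub>q"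

end

theory Submission
  imports Defs "Jordan_Normal_Form.Determinant"
begin

text \<open>
  The interpolant \<open>s\<^sub>z = \<Sum> (K\<^sup>-\<^sup>1 z)\<^sub>i w\<^sub>i\<close> of data \<open>z\<close> lies in the span of the Riesz representers, so any
  other interpolant \<open>s\<close> of \<open>z\<close> differs from it by a vector orthogonal to that span, and
  \<open>\<parallel>s\<parallel>\<^sup>2 = \<langle>z, K\<^sup>-\<^sup>1 z\<rangle> + \<parallel>s - s\<^sub>z\<parallel>\<^sup>2\<close>. Hence minimizing the norm amounts to minimizing the
  quadratic form over the feasible data. Existence of a minimizer follows because the data of
  feasible points of norm at most that of a given one lie in a compact box.
\<close>

section \<open>Riesz representers of continuous functionals\<close>

text \<open>Near \<open>t = 0\<close> the linear term dominates, so a small \<open>t\<close> of sign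
  opposite to \<open>b\<close> would make the expression negative. This is the first-variation
  argument for a minimizer.\<close>

lemma zero_le_quadratic_imp_zero:
  fixes b c :: real
  assumes nonneg: "\<And>t. 0 \<le> t * b + t\<^sup>2 * c"
  shows "b = 0"
proof -
  \<comment> \<open>At \<open>t = - b / d\<close> the expression equals
    \<open>b\<^sup>2 * (c - d) / d\<^sup>2\<close>; this choice of \<open>d\<close> is positive and
    exceeds \<open>c\<close>, so the value is negative unless \<open>b\<close> vanishes.\<close>
  define d where "d = \<bar>c\<bar> + 1"
  have d: "d > 0" "c < d"
    unfolding d_def by linarith+
  have "0 \<le> (- b / d) * b + (- b / d)\<^sup>2 * c"
    by (rule nonneg)
  also have "\<dots> = b\<^sup>2 * (c - d) / d\<^sup>2"
    using d by (simp add: field_simps power2_eq_square)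
  finally have "0 \<le> b\<^sup>2 * (c - d)"
    using d by (simp add: zero_le_divide_iff)
  then show ?thesis
    using d by (simp add: zero_le_mult_iff)
qed

text \<open>
  The representer is the minimizer of \<open>J\<close>: near-minimizers of \<open>J\<close> are close
  to each other by the parallelogram law, so completeness yields a minimizer, and the first
  variation of \<open>J\<close> vanishes there.
\<close>

lemma riesz_representation:
  fixes \<phi> :: "'h::{real_inner,complete_space} \<Rightarrow>\<^sub>L real"
  shows "\<exists>w. \<forall>s. blinfun_apply \<phi> s = inner s w"
proof -
  define J where "J s = inner s s / 2 - blinfun_apply \<phi> s" for s
  have parallelogram: "(norm (a - b))\<^sup>2 / 4 = J a + J b - 2 * J ((1 / 2) *\<^sub>R (a + b))" for a b
    by (simp add: J_def power2_norm_eq_inner blinfun.scaleR_right blinfun.add_right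
        inner_simps inner_commute field_simps)
  have lower: "- (norm \<phi>)\<^sup>2 / 2 \<le> J s" for s
  proof -
    have "blinfun_apply \<phi> s \<le> norm \<phi> * norm s"
      using norm_blinfun[of \<phi> s] by simp
    moreover have "2 * (norm \<phi> * norm s) \<le> (norm \<phi>)\<^sup>2 + (norm s)\<^sup>2"
      using sum_squares_bound[of "norm \<phi>" "norm s"] by (simp add: mult.assoc)
    moreover have "J s = (norm s)\<^sup>2 / 2 - blinfun_apply \<phi> s"
      by (simp add: J_def power2_norm_eq_inner)
    ultimately show ?thesis
      by linarith
  qed
  have bdd: "bdd_below (range J)"
    by (rule bdd_belowI2[OF lower])
  define d where "d = Inf (range J)"
  have d_le: "d \<le> J s" for s
    unfolding d_def by (rule cInf_lower[OF rangeI bdd])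
  \<comment> \<open>Sublevel sets of \<open>J\<close> just above its infimum: closed, nonempty,
    decreasing and of diameter tending to 0, so completeness gives them a common point, which
    minimizes \<open>J\<close>.\<close>
  define S where "S n = {s. J s \<le> d + inverse (real (Suc n))}" for n
  have "continuous_on UNIV J"
    unfolding J_def by (intro continuous_intros) simp
  then have closed: "closed (S n)" for n
    unfolding S_def by (intro closed_Collect_le continuous_intros)
  have nonempty: "S n \<noteq> {}" for n
  proof -
    have "Inf (range J) < d + inverse (real (Suc n))"
      by (simp add: d_def)
    then obtain s where "J s < d + inverse (real (Suc n))"
      using cInf_lessD[of "range J"] by blast
    then have "s \<in> S n"
      by (simp add: S_def)
    then show ?thesis
      by blast
  qed
  have mono: "S n \<subseteq> S m" if "m \<le> n" for m n
  proof
    fix s assume "s \<in> S n"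
    moreover have "inverse (real (Suc n)) \<le> inverse (real (Suc m))"
      using that by (intro le_imp_inverse_le) auto
    ultimately show "s \<in> S m"
      unfolding S_def mem_Collect_eq by linarith
  qed
  have small: "\<exists>n. \<forall>x\<in>S n. \<forall>y\<in>S n. dist x y < \<epsilon>" if "\<epsilon> > 0" for \<epsilon>
  proof -
    \<comment> \<open>For two points of \<open>S n\<close> the midpoint value is at least
      \<open>d\<close>, so the parallelogram identity bounds a quarter of the squared distance by
      twice \<open>inverse (real (Suc n))\<close>; hence the factor 8.\<close>
    have "0 < \<epsilon>\<^sup>2 / 8"
      using that by simp
    then obtain n where n: "inverse (real (Suc n)) < \<epsilon>\<^sup>2 / 8"
      using reals_Archimedean by blast
    have "dist x y < \<epsilon>" if "x \<in> S n" "y \<in> S n" for x y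
    proof -
      have "(norm (x - y))\<^sup>2 < \<epsilon>\<^sup>2"
        using parallelogram[of x y] d_le[of "(1 / 2) *\<^sub>R (x + y)"] that n
        by (simp add: S_def)
      then show ?thesis
        using \<open>\<epsilon> > 0\<close> by (simp add: dist_norm power_less_imp_less_base)
    qed
    then show ?thesis
      by blast
  qed
  obtain w where w: "w \<in> S n" for n
    using decreasing_closed_nest[of S, OF closed nonempty mono small] by blast
  have J_w: "J w \<le> d"
  proof (rule field_le_epsilon)
    fix e :: real assume "e > 0"
    then obtain n where "inverse (real (Suc n)) < e"
      using reals_Archimedean by blast
    then show "J w \<le> d + e"
      using w[of n] by (simp add: S_def)
  qed
  have "inner s w - blinfun_apply \<phi> s = 0" for s
  proof (rule zero_le_quadratic_imp_zero[where c = "inner s s / 2"])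
    fix t :: real
    have "J (w + t *\<^sub>R s) = J w + (t * (inner s w - blinfun_apply \<phi> s) + t\<^sup>2 * (inner s s / 2))"
      by (simp add: J_def blinfun.scaleR_right blinfun.add_right inner_simps inner_commute
          power2_eq_square field_simps)
    then show "0 \<le> t * (inner s w - blinfun_apply \<phi> s) + t\<^sup>2 * (inner s s / 2)"
      using J_w d_le[of "w + t *\<^sub>R s"] by simp
  qed
  then have "\<forall>s. blinfun_apply \<phi> s = inner s w"
    by simp
  then show ?thesis ..
qed

text \<open>\<open>riesz\<close> is a definite description, so existence has to be paired with
  uniqueness, which holds because a vector is determined by its inner products.\<close>

lemma riesz_apply: "blinfun_apply \<phi> s = inner s (riesz \<phi>)"
proof -
  obtain w where w: "\<forall>s. blinfun_apply \<phi> s = inner s w"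
    using riesz_representation by blast
  have unique: "w' = w" if "\<forall>s. blinfun_apply \<phi> s = inner s w'" for w'
    using that w by (metis inner_commute vector_eq_rdot)
  have "\<forall>s. blinfun_apply \<phi> s = inner s (riesz \<phi>)"
    unfolding riesz_def using w unique by (rule theI)
  then show ?thesis
    by blast
qed

section \<open>The Gramian and minimal-norm interpolation\<close>

text \<open>Independence of the image set alone would tolerate repeated functionals; injectivity
  rules these out, and together they say that the indexed family is independent.\<close>

locale independent_functionals =
  fixes m :: nat and \<Lambda> :: "nat \<Rightarrow> 'h::{real_inner,complete_space} \<Rightarrow>\<^sub>L real"
  assumes inj: "inj_on \<Lambda> {..<m}" and indep: "independent (\<Lambda> ` {..<m})"
begin

text \<open>Pairing with an arbitrary \<open>s\<close> turns a linear relation among the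
  representers into the same relation among the functionals.\<close>

lemma riesz_combination_eq_0D:
  assumes "(\<Sum>i<m. c i *\<^sub>R riesz (\<Lambda> i)) = 0" and "i < m"
  shows "c i = 0"
proof -
  have "(\<Sum>i<m. c i *\<^sub>R \<Lambda> i) = 0"
  proof (rule blinfun_eqI)
    fix s
    have "blinfun_apply (\<Sum>i<m. c i *\<^sub>R \<Lambda> i) s = inner s (\<Sum>i<m. c i *\<^sub>R riesz (\<Lambda> i))"
      by (simp add: blinfun.sum_left blinfun.scaleR_left inner_sum_right
          riesz_apply[of "\<Lambda> i" for i])
    then show "blinfun_apply (\<Sum>i<m. c i *\<^sub>R \<Lambda> i) s = blinfun_apply 0 s"
      using assms(1) by simp
  qed
  \<comment> \<open>Independence of a set speaks of coefficients attached to vectors; inverting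
    \<open>\<Lambda>\<close> on the index range transfers the coefficients \<open>c\<close> from
    indices to vectors.\<close>
  moreover have "(\<Sum>v\<in>\<Lambda> ` {..<m}. c (the_inv_into {..<m} \<Lambda> v) *\<^sub>R v) = (\<Sum>i<m. c i *\<^sub>R \<Lambda> i)"
    by (simp add: sum.reindex[OF inj] the_inv_into_f_f[OF inj])
  ultimately have "c (the_inv_into {..<m} \<Lambda> (\<Lambda> i)) = 0"
    using independentD[OF indep, of "\<Lambda> ` {..<m}" "\<lambda>v. c (the_inv_into {..<m} \<Lambda> v)" "\<Lambda> i"] assms(2)
    by simp
  then show ?thesis
    using assms(2) by (simp add: the_inv_into_f_f[OF inj])
qed

lemma gramian_carrier: "gramian m \<Lambda> \<in> carrier_mat m m"
  by (simp add: gramian_def)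

text \<open>This reads the linear system with the Gramian as an interpolation problem in the span of
  the representers.\<close>

lemma gramian_mult_vec:
  assumes "v \<in> carrier_vec m" and "j < m"
  shows "vec_index (gramian m \<Lambda> *\<^sub>v v) j
    = blinfun_apply (\<Lambda> j) (\<Sum>i<m. vec_index v i *\<^sub>R riesz (\<Lambda> i))"
  using assms
  by (simp add: gramian_def scalar_prod_def riesz_apply inner_sum_right inner_commute mult.commute
      lessThan_atLeast0)

text \<open>A kernel vector gives a combination \<open>u\<close> of the representers that is
  orthogonal to each of them, hence to itself. So \<open>u\<close> is 0, and independence kills the
  coefficients.\<close>

lemma det_gramian: "det (gramian m \<Lambda>) \<noteq> 0"
proof
  assume "det (gramian m \<Lambda>) = 0"
  then obtain v where v: "v \<in> carrier_vec m" "v \<noteq> 0\<^sub>v m" "gramian m \<Lambda> *\<^sub>v v = 0\<^sub>v m"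
    using det_0_iff_vec_prod_zero_field[OF gramian_carrier] by blast
  define u where "u = (\<Sum>i<m. vec_index v i *\<^sub>R riesz (\<Lambda> i))"
  have "inner u (riesz (\<Lambda> j)) = 0" if "j < m" for j
    using gramian_mult_vec[OF v(1) that] v(3) that by (simp add: u_def riesz_apply)
  \<comment> \<open>The second argument is \<open>u\<close> itself, so this says that
    \<open>inner u u\<close> is 0.\<close>
  then have "inner u (\<Sum>i<m. vec_index v i *\<^sub>R riesz (\<Lambda> i)) = 0"
    by (simp add: inner_sum_right)
  then have "u = 0"
    by (simp add: u_def[symmetric])
  then have "vec_index v i = 0" if "i < m" for i
    using riesz_combination_eq_0D[of "vec_index v"] that by (simp add: u_def)
  then have "v = 0\<^sub>v m"
    using v(1) by (intro eq_vecI) auto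
  with v(2) show False
    by blast
qed

abbreviation K_inv :: "real Matrix.mat" where
  "K_inv \<equiv> the (mat_inverse (gramian m \<Lambda>))"

text \<open>The nonzero determinant excludes the result \<open>None\<close>, so \<open>the\<close>
  yields a genuine inverse.\<close>

lemma gramian_inverse: "gramian m \<Lambda> * K_inv = 1\<^sub>m m" "K_inv \<in> carrier_mat m m"
proof -
  have "mat_inverse (gramian m \<Lambda>) \<noteq> None"
    using mat_inverse(1)[OF gramian_carrier, where b = "()"]
      det_non_zero_imp_unit[OF gramian_carrier det_gramian, where b = "()"]
    by blast
  then obtain B where "mat_inverse (gramian m \<Lambda>) = Some B"
    by blast
  with mat_inverse(2)[OF gramian_carrier this]
  show "gramian m \<Lambda> * K_inv = 1\<^sub>m m" "K_inv \<in> carrier_mat m m"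
    by auto
qed

definition interpolant :: "(nat \<Rightarrow> real) \<Rightarrow> 'h" where
  "interpolant z = (\<Sum>i<m. vec_index (K_inv *\<^sub>v Matrix.vec m z) i *\<^sub>R riesz (\<Lambda> i))"

lemma apply_interpolant:
  assumes "j < m"
  shows "blinfun_apply (\<Lambda> j) (interpolant z) = z j"
proof -
  have "gramian m \<Lambda> *\<^sub>v (K_inv *\<^sub>v Matrix.vec m z) = Matrix.vec m z"
    using assoc_mult_mat_vec[OF gramian_carrier gramian_inverse(2), of "Matrix.vec m z"]
    by (simp add: gramian_inverse(1))
  moreover have "K_inv *\<^sub>v Matrix.vec m z \<in> carrier_vec m"
    using gramian_inverse(2) by simp
  ultimately show ?thesis
    using gramian_mult_vec[of "K_inv *\<^sub>v Matrix.vec m z" j] assms by (simp add: interpolant_def)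
qed

text \<open>The interpolant is a combination of representers, so pairing it with \<open>s\<close>
  sees only the data of \<open>s\<close>. All elements with data \<open>z\<close> therefore give the
  same value, the interpolant included.\<close>

lemma inner_interpolant:
  assumes "\<And>i. i < m \<Longrightarrow> blinfun_apply (\<Lambda> i) s = z i"
  shows "inner s (interpolant z) = inverse_form m (gramian m \<Lambda>) z"
proof -
  have "inner s (interpolant z) = (\<Sum>i<m. vec_index (K_inv *\<^sub>v Matrix.vec m z) i * z i)"
    using assms by (simp add: interpolant_def inner_sum_right riesz_apply)
  also have "\<dots> = inverse_form m (gramian m \<Lambda>) z"
    using gramian_inverse(2)
    by (simp add: inverse_form_def scalar_prod_def lessThan_atLeast0 mult.commute)
  finally show ?thesis .
qed

lemma norm_interpolant: "(norm (interpolant z))\<^sup>2 = inverse_form m (gramian m \<Lambda>) z"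
  by (simp add: power2_norm_eq_inner inner_interpolant apply_interpolant)

text \<open>Pythagoras: by \<open>inner_interpolant\<close>, the difference
  \<open>s - interpolant z\<close> is orthogonal to \<open>interpolant z\<close>.\<close>

lemma norm_interpolation:
  assumes "\<And>i. i < m \<Longrightarrow> blinfun_apply (\<Lambda> i) s = z i"
  shows "(norm s)\<^sup>2 = inverse_form m (gramian m \<Lambda>) z + (norm (s - interpolant z))\<^sup>2"
proof -
  have "inner s (interpolant z) = inner (interpolant z) (interpolant z)"
    using assms by (simp add: inner_interpolant apply_interpolant)
  then show ?thesis
    unfolding norm_interpolant[symmetric]
    by (simp add: power2_norm_eq_inner inner_simps inner_commute)
qed

text \<open>The excess of the squared norm over its least value is the squared distance to the
  interpolant, which gives existence and uniqueness at once.\<close>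

lemma interpolant_arg_min_iff:
  "is_arg_min norm (\<lambda>s. \<forall>i<m. blinfun_apply (\<Lambda> i) s = z i) s \<longleftrightarrow> s = interpolant z"
proof
  assume *: "is_arg_min norm (\<lambda>s. \<forall>i<m. blinfun_apply (\<Lambda> i) s = z i) s"
  then have "norm s \<le> norm (interpolant z)"
    by (auto simp: is_arg_min_linorder apply_interpolant)
  then have "(norm s)\<^sup>2 \<le> inverse_form m (gramian m \<Lambda>) z"
    unfolding norm_interpolant[symmetric] by (simp add: power_mono)
  moreover have "(norm s)\<^sup>2 = inverse_form m (gramian m \<Lambda>) z + (norm (s - interpolant z))\<^sup>2"
    using * by (intro norm_interpolation) (auto simp: is_arg_min_def)
  ultimately show "s = interpolant z"
    by simp
next
  assume s: "s = interpolant z"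
  show "is_arg_min norm (\<lambda>s. \<forall>i<m. blinfun_apply (\<Lambda> i) s = z i) s"
    unfolding is_arg_min_linorder
  proof (intro conjI allI impI)
    show "blinfun_apply (\<Lambda> i) s = z i" if "i < m" for i
      using that by (simp add: s apply_interpolant)
    fix t assume "\<forall>i<m. blinfun_apply (\<Lambda> i) t = z i"
    then have "(norm t)\<^sup>2 = (norm s)\<^sup>2 + (norm (t - interpolant z))\<^sup>2"
      using norm_interpolation[of t z] by (simp add: s norm_interpolant)
    then have "(norm s)\<^sup>2 \<le> (norm t)\<^sup>2"
      by simp
    then show "norm s \<le> norm t"
      using norm_ge_zero power2_le_imp_le by blast
  qed
qed

text \<open>The form is a polynomial in the first \<open>m\<close> coordinates, so continuity of
  these suffices. It serves to attain a minimum on a compact set of data.\<close>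

lemma continuous_on_inverse_form:
  assumes "\<And>i. i < m \<Longrightarrow> continuous_on S (\<lambda>x. f x i)"
  shows "continuous_on S (\<lambda>x. inverse_form m (gramian m \<Lambda>) (f x))"
proof -
  have "inverse_form m (gramian m \<Lambda>) z
    = (\<Sum>i<m. z i * (\<Sum>j<m. K_inv $$ (i, j) * z j))" for z
    using gramian_inverse(2)
    by (simp add: inverse_form_def scalar_prod_def lessThan_atLeast0)
  then show ?thesis
    using assms by (auto intro!: continuous_intros)
qed

end

section \<open>Topology of tuples, and compactness of bounded feasible data\<close>

text \<open>Inside the space of all sequences the box is a product of compact intervals, continued
  by the singleton of 0 from index \<open>n\<close> on, so Tychonoff applies.\<close>

lemma compact_box_Euclidean_space:
  "compact {z \<in> topspace (Euclidean_space n). \<forall>i<n. \<bar>z i\<bar> \<le> b i}"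
proof -
  have "{z \<in> topspace (Euclidean_space n). \<forall>i<n. \<bar>z i\<bar> \<le> b i}
    = PiE UNIV (\<lambda>i. if i < n then {- b i..b i} else {0})"
    by (fastforce simp: topspace_Euclidean_space abs_le_iff split: if_splits)
  moreover have "compactin (product_topology (\<lambda>i. euclidean) UNIV)
      (PiE UNIV (\<lambda>i. if i < n then {- b i..b i} else {0}))"
    unfolding compactin_PiE by auto
  ultimately show ?thesis
    by (simp add: euclidean_product_topology)
qed

text \<open>\<open>Euclidean_space\<close> carries the subspace topology of the product topology,
  which is the topology of the function type.\<close>

lemma continuous_map_Euclidean_space_imp_continuous_on:
  assumes "continuous_map (Euclidean_space m) (Euclidean_space n) f"
  shows "continuous_on (topspace (Euclidean_space m)) f"
  using continuous_map_into_fulltopology assms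
  unfolding Euclidean_space_def euclidean_product_topology topspace_subtopology
  by (fastforce simp: continuous_map_iff_continuous)

lemma apply_functionals_in_Euclidean_space:
  "apply_functionals m \<phi> s \<in> topspace (Euclidean_space m)"
  by (simp add: topspace_Euclidean_space apply_functionals_def)

lemma apply_functionals_eq_iff:
  assumes "z \<in> topspace (Euclidean_space m)"
  shows "apply_functionals m \<phi> s = z \<longleftrightarrow> (\<forall>i<m. blinfun_apply (\<phi> i) s = z i)"
  using assms by (auto simp: topspace_Euclidean_space apply_functionals_def fun_eq_iff)

text \<open>\<open>P\<close> relates two stacked vectors whose entries may differ in type, such as
  functionals and their prescribed values.\<close>

lemma all_stack_iff:
  "(\<forall>i<m\<^sub>p + m\<^sub>q. P (stack m\<^sub>p f g i) (stack m\<^sub>p u v i))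
    \<longleftrightarrow> (\<forall>i<m\<^sub>p. P (f i) (u i)) \<and> (\<forall>i<m\<^sub>q. P (g i) (v i))" (is "?L \<longleftrightarrow> ?R")
proof
  assume L: ?L
  have "P (f i) (u i)" if "i < m\<^sub>p" for i
    using L[rule_format, of i] that by (simp add: stack_def)
  moreover have "P (g i) (v i)" if "i < m\<^sub>q" for i
    using L[rule_format, of "m\<^sub>p + i"] that by (simp add: stack_def)
  ultimately show ?R
    by blast
qed (auto simp: stack_def)

lemma interpolates_iff_stack:
  assumes "z\<^sub>p \<in> topspace (Euclidean_space m\<^sub>p)" and "z\<^sub>q \<in> topspace (Euclidean_space m\<^sub>q)"
  shows "interpolates m\<^sub>p m\<^sub>q \<phi>\<^sub>p \<phi>\<^sub>q z\<^sub>p z\<^sub>q s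
    \<longleftrightarrow> (\<forall>i<m\<^sub>p + m\<^sub>q. blinfun_apply (stack m\<^sub>p \<phi>\<^sub>p \<phi>\<^sub>q i) s = stack m\<^sub>p z\<^sub>p z\<^sub>q i)"
  unfolding interpolates_def apply_functionals_eq_iff[OF assms(1)] apply_functionals_eq_iff[OF assms(2)]
  by (rule all_stack_iff[symmetric, where P = "\<lambda>\<phi> x. blinfun_apply \<phi> s = x"])

text \<open>The constraints on \<open>z\<^sub>p\<close> and \<open>z\<^sub>q\<close> are uncoupled,
  so the set is a product; each factor is a compact box cut by the preimage of a closed set under a
  continuous map.\<close>

lemma compact_F_feasible_box:
  assumes p: "continuous_map (Euclidean_space m\<^sub>p) (Euclidean_space n\<^sub>p) p"
    and q: "continuous_map (Euclidean_space m\<^sub>q) (Euclidean_space n\<^sub>q) q"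
  shows "compact {(z\<^sub>p, z\<^sub>q). F_feasible m\<^sub>p m\<^sub>q n\<^sub>q p q r\<^sub>p r\<^sub>q (z\<^sub>p, z\<^sub>q) \<and>
    (\<forall>i<m\<^sub>p. \<bar>z\<^sub>p i\<bar> \<le> b\<^sub>p i) \<and> (\<forall>i<m\<^sub>q. \<bar>z\<^sub>q i\<bar> \<le> b\<^sub>q i)}"
proof -
  define B\<^sub>p where "B\<^sub>p = {z \<in> topspace (Euclidean_space m\<^sub>p). \<forall>i<m\<^sub>p. \<bar>z i\<bar> \<le> b\<^sub>p i}"
  define B\<^sub>q where "B\<^sub>q = {z \<in> topspace (Euclidean_space m\<^sub>q). \<forall>i<m\<^sub>q. \<bar>z i\<bar> \<le> b\<^sub>q i}"
  have compact: "compact B\<^sub>p" "compact B\<^sub>q"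
    unfolding B\<^sub>p_def B\<^sub>q_def by (rule compact_box_Euclidean_space)+
  have "continuous_on B\<^sub>p p" "continuous_on B\<^sub>q q"
    using continuous_map_Euclidean_space_imp_continuous_on[OF p]
      continuous_map_Euclidean_space_imp_continuous_on[OF q]
    by (auto simp: B\<^sub>p_def B\<^sub>q_def elim: continuous_on_subset)
  moreover have "closed {u. vec_ge n\<^sub>q u r\<^sub>q}"
    unfolding vec_ge_def
    by (intro closed_Collect_all closed_Collect_imp closed_Collect_le open_Collect_const
        continuous_on_product_coordinates continuous_on_const)
  ultimately have "closed (B\<^sub>p \<inter> p -` {r\<^sub>p})" "closed (B\<^sub>q \<inter> q -` {u. vec_ge n\<^sub>q u r\<^sub>q})"
    using compact[THEN compact_imp_closed] by (simp_all add: continuous_closed_preimage del: vimage_Collect_eq)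
  then have "compact (B\<^sub>p \<inter> p -` {r\<^sub>p})" "compact (B\<^sub>q \<inter> q -` {u. vec_ge n\<^sub>q u r\<^sub>q})"
    using compact by (metis compact_Int_closed inf_left_idem)+
  then have "compact ((B\<^sub>p \<inter> p -` {r\<^sub>p}) \<times> (B\<^sub>q \<inter> q -` {u. vec_ge n\<^sub>q u r\<^sub>q}))"
    by (rule compact_Times)
  also have "(B\<^sub>p \<inter> p -` {r\<^sub>p}) \<times> (B\<^sub>q \<inter> q -` {u. vec_ge n\<^sub>q u r\<^sub>q})
    = {(z\<^sub>p, z\<^sub>q). F_feasible m\<^sub>p m\<^sub>q n\<^sub>q p q r\<^sub>p r\<^sub>q (z\<^sub>p, z\<^sub>q) \<and>
      (\<forall>i<m\<^sub>p. \<bar>z\<^sub>p i\<bar> \<le> b\<^sub>p i) \<and> (\<forall>i<m\<^sub>q. \<bar>z\<^sub>q i\<bar> \<le> b\<^sub>q i)}"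
    by (auto simp: B\<^sub>p_def B\<^sub>q_def F_feasible_def)
  finally show ?thesis .
qed

section \<open>Equivalence of the two problems\<close>

theorem theorem3p6:
  fixes \<Omega> :: "'a set"
    and k :: "'a \<Rightarrow> 'a \<Rightarrow> real"
    and ev :: "'h::{real_inner,complete_space} \<Rightarrow> 'a \<Rightarrow> real"
    and m\<^sub>p m\<^sub>q n\<^sub>p n\<^sub>q :: nat
    and p q :: "(nat \<Rightarrow> real) \<Rightarrow> nat \<Rightarrow> real"
    and \<phi>\<^sub>p \<phi>\<^sub>q :: "nat \<Rightarrow> 'h \<Rightarrow>\<^sub>L real"
    and r\<^sub>p r\<^sub>q :: "nat \<Rightarrow> real"
  assumes "\<Omega> \<noteq> {}"
    and "positive_definite_kernel \<Omega> k"
    and "is_RKHS \<Omega> k ev"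
    and "m\<^sub>p \<ge> n\<^sub>p" and "m\<^sub>q \<ge> n\<^sub>q"
    and "continuous_map (Euclidean_space m\<^sub>p) (Euclidean_space n\<^sub>p) p"
    and "continuous_map (Euclidean_space m\<^sub>q) (Euclidean_space n\<^sub>q) q"
    and "r\<^sub>p \<in> topspace (Euclidean_space n\<^sub>p)" and "r\<^sub>q \<in> topspace (Euclidean_space n\<^sub>q)"
    and "inj_on (stack m\<^sub>p \<phi>\<^sub>p \<phi>\<^sub>q) {..<m\<^sub>p + m\<^sub>q}" and "independent (stack m\<^sub>p \<phi>\<^sub>p \<phi>\<^sub>q ` {..<m\<^sub>p + m\<^sub>q})"
    and "\<exists>s. P_feasible m\<^sub>p m\<^sub>q n\<^sub>q p q \<phi>\<^sub>p \<phi>\<^sub>q r\<^sub>p r\<^sub>q s"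
  shows "(\<exists>s. is_arg_min norm (P_feasible m\<^sub>p m\<^sub>q n\<^sub>q p q \<phi>\<^sub>p \<phi>\<^sub>q r\<^sub>p r\<^sub>q) s) \<and>
    (\<forall>z\<^sub>p z\<^sub>q.
       is_arg_min (F_objective m\<^sub>p m\<^sub>q (stack m\<^sub>p \<phi>\<^sub>p \<phi>\<^sub>q))
         (F_feasible m\<^sub>p m\<^sub>q n\<^sub>q p q r\<^sub>p r\<^sub>q) (z\<^sub>p, z\<^sub>q) \<longrightarrow>
       (\<exists>!s. is_arg_min norm (interpolates m\<^sub>p m\<^sub>q \<phi>\<^sub>p \<phi>\<^sub>q z\<^sub>p z\<^sub>q) s) \<and>
       (\<forall>s. is_arg_min norm (interpolates m\<^sub>p m\<^sub>q \<phi>\<^sub>p \<phi>\<^sub>q z\<^sub>p z\<^sub>q) s \<longrightarrow>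
            is_arg_min norm (P_feasible m\<^sub>p m\<^sub>q n\<^sub>q p q \<phi>\<^sub>p \<phi>\<^sub>q r\<^sub>p r\<^sub>q) s)) \<and>
    (\<forall>s. is_arg_min norm (P_feasible m\<^sub>p m\<^sub>q n\<^sub>q p q \<phi>\<^sub>p \<phi>\<^sub>q r\<^sub>p r\<^sub>q) s \<longrightarrow>
       is_arg_min (F_objective m\<^sub>p m\<^sub>q (stack m\<^sub>p \<phi>\<^sub>p \<phi>\<^sub>q))
         (F_feasible m\<^sub>p m\<^sub>q n\<^sub>q p q r\<^sub>p r\<^sub>q)
         (apply_functionals m\<^sub>p \<phi>\<^sub>p s, apply_functionals m\<^sub>q \<phi>\<^sub>q s))"
proof -
  define \<Lambda> where "\<Lambda> = stack m\<^sub>p \<phi>\<^sub>p \<phi>\<^sub>q"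
  interpret independent_functionals "m\<^sub>p + m\<^sub>q" \<Lambda>
    using assms(10,11) by unfold_locales (simp_all add: \<Lambda>_def)
  let ?P = "P_feasible m\<^sub>p m\<^sub>q n\<^sub>q p q \<phi>\<^sub>p \<phi>\<^sub>q r\<^sub>p r\<^sub>q"
  let ?F = "F_feasible m\<^sub>p m\<^sub>q n\<^sub>q p q r\<^sub>p r\<^sub>q"
  let ?obj = "F_objective m\<^sub>p m\<^sub>q \<Lambda>"
  \<comment> \<open>\<open>?data\<close> and \<open>?interp\<close> carry points between (P) and
    (F). Both preserve feasibility, and \<open>?interp\<close> is a right inverse of
    \<open>?data\<close> on feasible data.\<close>
  let ?data = "\<lambda>s. (apply_functionals m\<^sub>p \<phi>\<^sub>p s, apply_functionals m\<^sub>q \<phi>\<^sub>q s)"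
  let ?interp = "\<lambda>(z\<^sub>p, z\<^sub>q). interpolant (stack m\<^sub>p z\<^sub>p z\<^sub>q)"
  have data_feasible: "?F (?data s)" if "?P s" for s
    using that by (simp add: P_feasible_def F_feasible_def apply_functionals_in_Euclidean_space)
  \<comment> \<open>This is the Pythagorean identity without its nonnegative remainder; at
    interpolants it becomes the equality \<open>norm_interp\<close>.\<close>
  have obj_data: "?obj (?data s) \<le> (norm s)\<^sup>2" for s
  proof -
    have "interpolates m\<^sub>p m\<^sub>q \<phi>\<^sub>p \<phi>\<^sub>q (apply_functionals m\<^sub>p \<phi>\<^sub>p s) (apply_functionals m\<^sub>q \<phi>\<^sub>q s) s"
      by (simp add: interpolates_def)
    then show ?thesis
      using norm_interpolation[of s
          "stack m\<^sub>p (apply_functionals m\<^sub>p \<phi>\<^sub>p s) (apply_functionals m\<^sub>q \<phi>\<^sub>q s)"]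
      by (simp add: interpolates_iff_stack apply_functionals_in_Euclidean_space F_objective_def \<Lambda>_def)
  qed
  have norm_interp: "(norm (?interp z))\<^sup>2 = ?obj z" for z
    by (cases z) (simp add: norm_interpolant F_objective_def)
  have data_interp: "?data (?interp z) = z" if "?F z" for z
  proof (cases z)
    case (Pair z\<^sub>p z\<^sub>q)
    then have "z\<^sub>p \<in> topspace (Euclidean_space m\<^sub>p)" "z\<^sub>q \<in> topspace (Euclidean_space m\<^sub>q)"
      using that by (simp_all add: F_feasible_def)
    then have "interpolates m\<^sub>p m\<^sub>q \<phi>\<^sub>p \<phi>\<^sub>q z\<^sub>p z\<^sub>q (?interp z)"
      using apply_interpolant by (simp add: interpolates_iff_stack \<Lambda>_def Pair)
    then show ?thesis
      by (simp add: interpolates_def Pair)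
  qed
  have interp_feasible: "?P (?interp z)" if "?F z" for z
    using data_interp[OF that] that by (auto simp: P_feasible_def F_feasible_def)
  \<comment> \<open>The chain is \<open>(norm (?interp z))\<^sup>2 = ?obj z \<le> ?obj (?data s)
    \<le> (norm s)\<^sup>2\<close>.\<close>
  have F_imp_P: "is_arg_min norm ?P (?interp z)" if "is_arg_min ?obj ?F z" for z
    unfolding is_arg_min_linorder
  proof (intro conjI allI impI)
    show "?P (?interp z)"
      using that interp_feasible by (simp add: is_arg_min_linorder)
    fix s assume "?P s"
    then have "?obj z \<le> ?obj (?data s)"
      using that data_feasible by (simp add: is_arg_min_linorder)
    then have "(norm (?interp z))\<^sup>2 \<le> (norm s)\<^sup>2"
      using obj_data[of s] by (simp add: norm_interp)
    then show "norm (?interp z) \<le> norm s"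
      using norm_ge_zero power2_le_imp_le by blast
  qed
  \<comment> \<open>The chain is \<open>?obj (?data s) \<le> (norm s)\<^sup>2 \<le> (norm (?interp
    z))\<^sup>2 = ?obj z\<close>.\<close>
  have P_imp_F: "is_arg_min ?obj ?F (?data s)" if "is_arg_min norm ?P s" for s
    unfolding is_arg_min_linorder
  proof (intro conjI allI impI)
    show "?F (?data s)"
      using that data_feasible by (simp add: is_arg_min_linorder)
    fix z assume "?F z"
    then have "norm s \<le> norm (?interp z)"
      using that interp_feasible by (simp add: is_arg_min_linorder)
    then have "(norm s)\<^sup>2 \<le> ?obj z"
      unfolding norm_interp[symmetric] by (simp add: power_mono)
    then show "?obj (?data s) \<le> ?obj z"
      using obj_data[of s] by simp
  qed
  have arg_min_interp: "is_arg_min norm (interpolates m\<^sub>p m\<^sub>q \<phi>\<^sub>p \<phi>\<^sub>q z\<^sub>p z\<^sub>q) s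
      \<longleftrightarrow> s = ?interp (z\<^sub>p, z\<^sub>q)" if "?F (z\<^sub>p, z\<^sub>q)" for z\<^sub>p z\<^sub>q s
  proof -
    have "interpolates m\<^sub>p m\<^sub>q \<phi>\<^sub>p \<phi>\<^sub>q z\<^sub>p z\<^sub>q
      = (\<lambda>s. \<forall>i<m\<^sub>p + m\<^sub>q. blinfun_apply (\<Lambda> i) s = stack m\<^sub>p z\<^sub>p z\<^sub>q i)"
      using that by (simp add: fun_eq_iff interpolates_iff_stack F_feasible_def \<Lambda>_def)
    then show ?thesis
      by (simp add: interpolant_arg_min_iff)
  qed

  \<comment> \<open>Existence of a minimizer of (P)\<close>
  obtain s\<^sub>0 where s\<^sub>0: "?P s\<^sub>0"
    using assms(12) by blast
  \<comment> \<open>The bounds come from the operator norm inequality, so \<open>C\<close> contains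
    the data of every feasible element of norm at most that of \<open>s\<^sub>0\<close>.\<close>
  define C where "C = {(z\<^sub>p, z\<^sub>q). ?F (z\<^sub>p, z\<^sub>q) \<and>
    (\<forall>i<m\<^sub>p. \<bar>z\<^sub>p i\<bar> \<le> norm (\<phi>\<^sub>p i) * norm s\<^sub>0) \<and> (\<forall>i<m\<^sub>q. \<bar>z\<^sub>q i\<bar> \<le> norm (\<phi>\<^sub>q i) * norm s\<^sub>0)}"
  have bound: "\<bar>blinfun_apply \<phi> s\<bar> \<le> norm \<phi> * norm s\<^sub>0" if "norm s \<le> norm s\<^sub>0"
    for \<phi> :: "'h \<Rightarrow>\<^sub>L real" and s
    using norm_blinfun[of \<phi> s] mult_left_mono[OF that norm_ge_zero[of \<phi>]] by simp
  have data_in_C: "?data s \<in> C" if "?P s" "norm s \<le> norm s\<^sub>0" for s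
    using data_feasible[OF that(1)] bound[OF that(2)] by (simp add: C_def apply_functionals_def)
  have "compact C"
    unfolding C_def by (rule compact_F_feasible_box[OF assms(6,7)])
  moreover have "C \<noteq> {}"
    using data_in_C[OF s\<^sub>0] by blast
  moreover have "continuous_on C ?obj"
    unfolding F_objective_def case_prod_unfold
  proof (rule continuous_on_inverse_form)
    fix i
    have "continuous_on C (\<lambda>z. fst z i)" "continuous_on C (\<lambda>z. snd z (i - m\<^sub>p))"
      by (rule continuous_on_product_then_coordinatewise,
          intro continuous_on_fst continuous_on_snd continuous_on_id)+
    then show "continuous_on C (\<lambda>z. stack m\<^sub>p (fst z) (snd z) i)"
      by (cases "i < m\<^sub>p") (simp_all add: stack_def)
  qed
  ultimately obtain z where z: "z \<in> C" "\<And>y. y \<in> C \<Longrightarrow> ?obj z \<le> ?obj y"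
    using continuous_attains_inf[of C ?obj] by blast
  then have "?F z"
    by (auto simp: C_def)
  have le: "norm (?interp z) \<le> norm s" if "?P s" "norm s \<le> norm s\<^sub>0" for s
  proof -
    have "(norm (?interp z))\<^sup>2 \<le> (norm s)\<^sup>2"
      using z(2)[OF data_in_C[OF that]] obj_data[of s] by (simp add: norm_interp)
    then show ?thesis
      using norm_ge_zero power2_le_imp_le by blast
  qed
  have "is_arg_min norm ?P (?interp z)"
    unfolding is_arg_min_linorder
  proof (intro conjI allI impI)
    show "?P (?interp z)"
      using interp_feasible[OF \<open>?F z\<close>] .
    \<comment> \<open>A feasible \<open>s\<close> longer than \<open>s\<^sub>0\<close> may have data
      outside \<open>C\<close>; in that case the bound for \<open>s\<^sub>0\<close> itself is
      enough.\<close>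
    show "norm (?interp z) \<le> norm s" if "?P s" for s
      using le[OF that] le[OF s\<^sub>0] by linarith
  qed
  moreover have "(\<exists>!s. is_arg_min norm (interpolates m\<^sub>p m\<^sub>q \<phi>\<^sub>p \<phi>\<^sub>q z\<^sub>p z\<^sub>q) s) \<and>
      (\<forall>s. is_arg_min norm (interpolates m\<^sub>p m\<^sub>q \<phi>\<^sub>p \<phi>\<^sub>q z\<^sub>p z\<^sub>q) s \<longrightarrow> is_arg_min norm ?P s)"
    if "is_arg_min ?obj ?F (z\<^sub>p, z\<^sub>q)" for z\<^sub>p z\<^sub>q
  proof -
    have "?F (z\<^sub>p, z\<^sub>q)"
      using that by (simp add: is_arg_min_def)
    then show ?thesis
      using F_imp_P[OF that] by (simp add: arg_min_interp)
  qed
  ultimately show ?thesis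
    using P_imp_F unfolding \<Lambda>_def by blast
qed

end
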